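(* Let $H$ be a real Hilbert space, $C\subseteq H$ a nonempty convex subset, $0\leq\kappa<1$, and let $T:C\to C$ be a $\kappa$-strict pseudo-contraction. Let $\lambda\in(\kappa,1)$. Let $x\in C$ and $b>0$ be such that $\|x-Tx\|\leq b$ and $T$ has approximate fixed points in a $b$-neighborhood of $x$. Let $(x_n)$ be the Krasnoselskii iteration starting with $x$, that is, $x_0:=x$ and $x_{n+1}:=\lambda x_n+(1-\lambda)Tx_n$ for all $n\in\mathbb{N}$. Then for every $\varepsilon>0$ and every $n\geq\Phi(\varepsilon,b,\lambda,\kappa)$ one has $\|x_n-Tx_n\|<\varepsilon$, where $$\Phi(\varepsilon,b,\lambda,\kappa)=\left\lceil\frac{1}{(\lambda-\kappa)(1-\lambda)}\right\rceil\left\lceil\frac{b^2}{\varepsilon^2}\right\rceil.$$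
   Context: $\mathbb{N}=\{0,1,2,\dots\}$. For $0\leq\kappa<1$, a mapping $T:C\to C$ is a $\kappa$-strict pseudo-contraction if for all $u,v\in C$, $\|Tu-Tv\|^2\leq\|u-v\|^2+\kappa\|u-Tu-(v-Tv)\|^2$. $T$ has approximate fixed points in a $b$-neighborhood of $x$ if for every $\delta>0$ there exists $y\in C$ with $\|x-y\|\leq b$ and $\|y-Ty\|<\delta$. *)

theory Defs
  imports "HOL-Analysis.Analysis"
begin

definition strict_pseudo_contraction_on ::
  "real \<Rightarrow> 'a::real_inner set \<Rightarrow> ('a \<Rightarrow> 'a) \<Rightarrow> bool" where
  "strict_pseudo_contraction_on \<kappa> C T \<longleftrightarrow>
     (\<forall>u\<in>C. \<forall>v\<in>C.
        (norm (T u - T v))\<^sup>2 \<le> (norm (u - v))\<^sup>2 + \<kappa> * (norm (u - T u - (v - T v)))\<^sup>2)"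

definition approx_fixed_points_in_nbhd ::
  "'a::real_normed_vector set \<Rightarrow> ('a \<Rightarrow> 'a) \<Rightarrow> 'a \<Rightarrow> real \<Rightarrow> bool" where
  "approx_fixed_points_in_nbhd C T x b \<longleftrightarrow>
     (\<forall>\<delta>>0. \<exists>y\<in>C. norm (x - y) \<le> b \<and> norm (y - T y) < \<delta>)"

primrec krasnoselskii :: "real \<Rightarrow> ('a::real_vector \<Rightarrow> 'a) \<Rightarrow> 'a \<Rightarrow> nat \<Rightarrow> 'a" where
  "krasnoselskii lam T x 0 = x"
| "krasnoselskii lam T x (Suc n) =
     lam *\<^sub>R krasnoselskii lam T x n + (1 - lam) *\<^sub>R T (krasnoselskii lam T x n)"

definition Phi :: "real \<Rightarrow> real \<Rightarrow> real \<Rightarrow> real \<Rightarrow> int" where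
  "Phi \<epsilon> b lam \<kappa> = \<lceil>1 / ((lam - \<kappa>) * (1 - lam))\<rceil> * \<lceil>b\<^sup>2 / \<epsilon>\<^sup>2\<rceil>"

end

theory Submission
  imports Defs
begin

text \<open>
  The averaged map \<open>S = \<lambda> I + (1 - \<lambda>) T\<close> satisfies, with \<open>c = (\<lambda> - \<kappa>)(1 - \<lambda>)\<close>,
  \<open>|Su - Sv|^2 \<le> |u - v|^2 - c |(u - Tu) - (v - Tv)|^2\<close>. In particular \<open>S\<close> is nonexpansive,
  so residuals decrease along its orbits. Compare the orbit of \<open>x\<close> with the orbit of an
  approximate fixed point \<open>y\<close>, rather than with \<open>y\<close> itself: telescoping the inequality over
  \<open>n + 1\<close> steps involves no error terms and yields
  \<open>|x_n - T x_n| \<le> |y - Ty| + |x - y| / sqrt ((n + 1) c)\<close>. Letting \<open>|y - Ty|\<close> tend to \<open>0\<close> gives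
  \<open>|x_n - T x_n| \<le> b / sqrt ((n + 1) c)\<close>.
\<close>

lemma norm_sq_affine_combination:
  fixes d e :: "'a::real_inner"
  shows "(norm (t *\<^sub>R d + (1 - t) *\<^sub>R e))\<^sup>2
         = t * (norm d)\<^sup>2 + (1 - t) * (norm e)\<^sup>2 - t * (1 - t) * (norm (d - e))\<^sup>2"
  unfolding power2_norm_eq_inner
  by (simp add: inner_add_left inner_add_right inner_diff_left inner_diff_right
      inner_commute[of e d] algebra_simps)

text \<open>Expanding the square of the affine combination produces the term
  \<open>- lam * (1 - lam)\<close> times the squared residual difference, while the hypothesis on
  \<open>T\<close>, weighted by \<open>1 - lam\<close>, costs \<open>\<kappa> * (1 - lam)\<close>
  times the same quantity. The net coefficient is
  \<open>- (lam - \<kappa>) * (1 - lam)\<close>.\<close>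

lemma strict_pseudo_contraction_averaged:
  fixes T :: "'a::real_inner \<Rightarrow> 'a"
  assumes T: "strict_pseudo_contraction_on \<kappa> C T"
    and lam: "lam \<le> 1"
    and uv: "u \<in> C" "v \<in> C"
  shows "(norm ((lam *\<^sub>R u + (1 - lam) *\<^sub>R T u) - (lam *\<^sub>R v + (1 - lam) *\<^sub>R T v)))\<^sup>2
         \<le> (norm (u - v))\<^sup>2 - (lam - \<kappa>) * (1 - lam) * (norm (u - T u - (v - T v)))\<^sup>2"
proof -
  have split: "(lam *\<^sub>R u + (1 - lam) *\<^sub>R T u) - (lam *\<^sub>R v + (1 - lam) *\<^sub>R T v)
      = lam *\<^sub>R (u - v) + (1 - lam) *\<^sub>R (T u - T v)"
    by (simp add: algebra_simps)
  have diff: "u - v - (T u - T v) = u - T u - (v - T v)"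
    by simp
  have "(norm (T u - T v))\<^sup>2 \<le> (norm (u - v))\<^sup>2 + \<kappa> * (norm (u - T u - (v - T v)))\<^sup>2"
    using T uv unfolding strict_pseudo_contraction_on_def by blast
  then have "(1 - lam) * (norm (T u - T v))\<^sup>2
      \<le> (1 - lam) * ((norm (u - v))\<^sup>2 + \<kappa> * (norm (u - T u - (v - T v)))\<^sup>2)"
    using lam by (intro mult_left_mono) auto
  then show ?thesis
    unfolding split norm_sq_affine_combination diff by (simp add: algebra_simps)
qed

lemma krasnoselskii_in_convex:
  assumes "convex C" "T ` C \<subseteq> C" "0 \<le> lam" "lam \<le> 1" "x \<in> C"
  shows "krasnoselskii lam T x n \<in> C"
proof (induction n)
  case (Suc n)
  then show ?case
    using assms by (auto intro!: convexD)
qed (simp add: assms)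

lemma krasnoselskii_step:
  "krasnoselskii lam T x n - krasnoselskii lam T x (Suc n)
   = (1 - lam) *\<^sub>R (krasnoselskii lam T x n - T (krasnoselskii lam T x n))"
  by (simp add: algebra_simps)

locale krasnoselskii_iteration =
  fixes C :: "'a::real_inner set" and T :: "'a \<Rightarrow> 'a" and \<kappa> lam :: real
  assumes convex: "convex C"
    and maps: "T ` C \<subseteq> C"
    and spc: "strict_pseudo_contraction_on \<kappa> C T"
    and lam: "0 \<le> lam" "\<kappa> < lam" "lam < 1"
begin

abbreviation orbit :: "'a \<Rightarrow> nat \<Rightarrow> 'a" where
  "orbit \<equiv> krasnoselskii lam T"

abbreviation res :: "'a \<Rightarrow> 'a" where
  "res u \<equiv> u - T u"

lemma orbit_in: "x \<in> C \<Longrightarrow> orbit x n \<in> C"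
  using krasnoselskii_in_convex[OF convex maps] lam by simp

lemma gain_pos: "0 < (lam - \<kappa>) * (1 - lam)"
  using lam by simp

text \<open>Averaging maps two consecutive iterates to the next two, so step lengths cannot grow.
  Each step is \<open>1 - lam\<close> times a residual, and this positive factor cancels.\<close>

lemma residual_Suc_le:
  assumes "x \<in> C"
  shows "norm (res (orbit x (Suc n))) \<le> norm (res (orbit x n))"
proof -
  let ?u = "orbit x n" and ?v = "orbit x (Suc n)"
  have "(norm (?v - orbit x (Suc (Suc n))))\<^sup>2 \<le> (norm (?u - ?v))\<^sup>2
      - (lam - \<kappa>) * (1 - lam) * (norm (res ?u - res ?v))\<^sup>2"
    using strict_pseudo_contraction_averaged[OF spc _ orbit_in orbit_in,
        OF _ assms assms, of lam n "Suc n"] lam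
    by simp
  also have "\<dots> \<le> (norm (?u - ?v))\<^sup>2"
    using gain_pos by simp
  finally have "norm (?v - orbit x (Suc (Suc n))) \<le> norm (?u - ?v)"
    by (rule power2_le_imp_le) simp
  then show ?thesis
    using lam unfolding krasnoselskii_step by simp
qed

lemma residual_antimono:
  assumes "x \<in> C" "m \<le> n"
  shows "norm (res (orbit x n)) \<le> norm (res (orbit x m))"
  using lift_Suc_antimono_le[of "\<lambda>k. norm (res (orbit x k))"] residual_Suc_le assms by blast

text \<open>Both orbits move under the same averaged map, so each step pays for its summand by a
  drop in the squared distance. Keeping the final distance on the right is what lets the induction
  telescope.\<close>

lemma sum_residual_diff_le:
  assumes "x \<in> C" "y \<in> C"
  shows "(lam - \<kappa>) * (1 - lam) * (\<Sum>i<n. (norm (res (orbit x i) - res (orbit y i)))\<^sup>2)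
         \<le> (norm (x - y))\<^sup>2 - (norm (orbit x n - orbit y n))\<^sup>2"
proof (induction n)
  case (Suc n)
  have "(norm (orbit x (Suc n) - orbit y (Suc n)))\<^sup>2 \<le> (norm (orbit x n - orbit y n))\<^sup>2
      - (lam - \<kappa>) * (1 - lam) * (norm (res (orbit x n) - res (orbit y n)))\<^sup>2"
    using strict_pseudo_contraction_averaged[OF spc _ orbit_in orbit_in, OF _ assms, of lam n n] lam
    by simp
  with Suc.IH show ?case
    by (simp add: distrib_left del: krasnoselskii.simps)
qed simp

text \<open>For \<open>i \<le> n\<close> the residual of the orbit of \<open>x\<close> is at least
  its value at \<open>n\<close>, and that of the orbit of \<open>y\<close> is at most its initial
  value. Hence all \<open>n + 1\<close> summands of the telescoped bound are at least the square of
  the difference of these two values.\<close>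

lemma residual_le_compare:
  assumes "x \<in> C" "y \<in> C"
  shows "norm (res (orbit x n))
         \<le> norm (res y) + norm (x - y) / sqrt (real (Suc n) * ((lam - \<kappa>) * (1 - lam)))"
\<comment> \<open>Squaring \<open>?r\<close> preserves lower bounds only if \<open>?r\<close> is
  nonnegative; otherwise the claim is immediate, since the quotient is nonnegative.\<close>
proof (cases "norm (res (orbit x n)) \<le> norm (res y)")
  case True
  then show ?thesis
    using gain_pos by (simp add: add_increasing2)
next
  case False
  let ?c = "(lam - \<kappa>) * (1 - lam)"
  let ?r = "norm (res (orbit x n)) - norm (res y)"
  have r: "?r\<^sup>2 \<le> (norm (res (orbit x i) - res (orbit y i)))\<^sup>2" if "i < Suc n" for i
  proof -
    have "norm (res (orbit x n)) \<le> norm (res (orbit x i))"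
      using residual_antimono[OF assms(1)] that by simp
    moreover have "norm (res (orbit y i)) \<le> norm (res y)"
      using residual_antimono[OF assms(2), of 0 i] by simp
    moreover have "norm (res (orbit x i)) - norm (res (orbit y i))
        \<le> norm (res (orbit x i) - res (orbit y i))"
      by (rule norm_triangle_ineq2)
    ultimately show ?thesis
      using False by (intro power_mono) linarith+
  qed
  have "real (Suc n) * ?r\<^sup>2 \<le> (\<Sum>i<Suc n. (norm (res (orbit x i) - res (orbit y i)))\<^sup>2)"
    using sum_bounded_below[of "{..<Suc n}" "?r\<^sup>2"
        "\<lambda>i. (norm (res (orbit x i) - res (orbit y i)))\<^sup>2"] r by simp
  then have "?c * (real (Suc n) * ?r\<^sup>2)
      \<le> ?c * (\<Sum>i<Suc n. (norm (res (orbit x i) - res (orbit y i)))\<^sup>2)"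
    using gain_pos by (intro mult_left_mono) auto
  also have "\<dots> \<le> (norm (x - y))\<^sup>2"
    using sum_residual_diff_le[OF assms, of "Suc n"]
      zero_le_power2[of "norm (orbit x (Suc n) - orbit y (Suc n))"] by linarith
  finally have "real (Suc n) * ?c * ?r\<^sup>2 \<le> (norm (x - y))\<^sup>2"
    by (simp only: mult_ac)
  moreover have "(sqrt (real (Suc n) * ?c))\<^sup>2 = real (Suc n) * ?c"
    using gain_pos by (intro real_sqrt_pow2) simp
  ultimately have "(sqrt (real (Suc n) * ?c) * ?r)\<^sup>2 \<le> (norm (x - y))\<^sup>2"
    by (simp only: power_mult_distrib)
  then have "sqrt (real (Suc n) * ?c) * ?r \<le> norm (x - y)"
    by (rule power2_le_imp_le) simp
  moreover have "sqrt (real (Suc n) * ?c) > 0"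
    using gain_pos by simp
  ultimately have "?r \<le> norm (x - y) / sqrt (real (Suc n) * ?c)"
    by (metis mult.commute pos_le_divide_eq)
  then show ?thesis
    by linarith
qed

text \<open>The point \<open>y\<close> varies with \<open>\<delta>\<close>, but its distance to
  \<open>x\<close> stays below the fixed \<open>b\<close>, so only the residual of \<open>y\<close>
  depends on \<open>\<delta>\<close> and it can be made arbitrarily small.\<close>

lemma residual_le:
  assumes "x \<in> C" and afp: "approx_fixed_points_in_nbhd C T x b"
  shows "norm (res (orbit x n)) \<le> b / sqrt (real (Suc n) * ((lam - \<kappa>) * (1 - lam)))"
proof (rule field_le_epsilon)
  fix \<delta> :: real
  assume "0 < \<delta>"
  then obtain y where y: "y \<in> C" "norm (x - y) \<le> b" "norm (res y) < \<delta>"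
    using afp unfolding approx_fixed_points_in_nbhd_def by blast
  let ?s = "sqrt (real (Suc n) * ((lam - \<kappa>) * (1 - lam)))"
  have "norm (x - y) / ?s \<le> b / ?s"
    using y(2) gain_pos by (intro divide_right_mono) auto
  then show "norm (res (orbit x n)) \<le> b / ?s + \<delta>"
    using residual_le_compare[OF assms(1) y(1), of n] y(3) by linarith
qed

end

lemma Phi_imp_sq_less:
  assumes pos: "0 < (lam - \<kappa>) * (1 - lam)" "0 < \<epsilon>" and n: "Phi \<epsilon> b lam \<kappa> \<le> int n"
  shows "b\<^sup>2 < \<epsilon>\<^sup>2 * (real (Suc n) * ((lam - \<kappa>) * (1 - lam)))"
proof -
  let ?c = "(lam - \<kappa>) * (1 - lam)"
  have "1 / ?c * (b\<^sup>2 / \<epsilon>\<^sup>2) \<le> of_int \<lceil>1 / ?c\<rceil> * of_int \<lceil>b\<^sup>2 / \<epsilon>\<^sup>2\<rceil>"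
  proof (rule mult_mono)
    show "0 \<le> real_of_int \<lceil>1 / ?c\<rceil>"
      using pos(1) by (meson le_of_int_ceiling less_imp_le order_trans zero_le_divide_1_iff)
  qed (simp_all add: le_of_int_ceiling)
  also have "\<dots> = of_int (Phi \<epsilon> b lam \<kappa>)"
    unfolding Phi_def by simp
  also have "\<dots> \<le> real n"
    using n by linarith
  \<comment> \<open>Strictness comes from here: the indices \<open>0\<close> to \<open>n\<close>
    give \<open>n + 1\<close> summands, one more than \<open>Phi\<close> demands.\<close>
  also have "\<dots> < real (Suc n)"
    by simp
  finally have "b\<^sup>2 / (\<epsilon>\<^sup>2 * ?c) < real (Suc n)"
    by (simp add: mult.commute)
  moreover have "0 < \<epsilon>\<^sup>2 * ?c"
    using pos zero_less_power mult_pos_pos by blast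
  ultimately have "b\<^sup>2 < real (Suc n) * (\<epsilon>\<^sup>2 * ?c)"
    by (simp only: pos_divide_less_eq)
  then show ?thesis
    by (simp only: mult_ac)
qed

theorem mainTheorem2:
  fixes C :: "'a::{real_inner, complete_space} set"
    and T :: "'a \<Rightarrow> 'a"
    and \<kappa> lam b :: real
    and x :: 'a
  assumes "C \<noteq> {}"
    and "convex C"
    and "0 \<le> \<kappa>" and "\<kappa> < 1"
    and "T ` C \<subseteq> C"
    and "strict_pseudo_contraction_on \<kappa> C T"
    and "\<kappa> < lam" and "lam < 1"
    and "x \<in> C"
    and "b > 0"
    and "norm (x - T x) \<le> b"
    and "approx_fixed_points_in_nbhd C T x b"
  shows "\<forall>\<epsilon>>0. \<forall>n::nat. int n \<ge> Phi \<epsilon> b lam \<kappa> \<longrightarrow>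
           norm (krasnoselskii lam T x n - T (krasnoselskii lam T x n)) < \<epsilon>"
proof (intro allI impI)
  fix \<epsilon> :: real and n :: nat
  assume \<epsilon>: "0 < \<epsilon>" and n: "Phi \<epsilon> b lam \<kappa> \<le> int n"
  interpret krasnoselskii_iteration C T \<kappa> lam
    using assms by unfold_locales auto
  let ?m = "real (Suc n) * ((lam - \<kappa>) * (1 - lam))"
  have m: "0 < ?m"
    using gain_pos by simp
  have "b\<^sup>2 < (\<epsilon> * sqrt ?m)\<^sup>2"
    using Phi_imp_sq_less[OF gain_pos \<epsilon> n] m by (simp add: power_mult_distrib)
  then have "b < \<epsilon> * sqrt ?m"
    by (rule power2_less_imp_less) (use \<epsilon> m in simp)
  then have "b / sqrt ?m < \<epsilon>"
    using m by (simp only: pos_divide_less_eq real_sqrt_gt_0_iff)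
  with residual_le[OF \<open>x \<in> C\<close> \<open>approx_fixed_points_in_nbhd C T x b\<close>]
  show "norm (orbit x n - T (orbit x n)) < \<epsilon>"
    by (rule le_less_trans)
qed

end
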